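(* Let $d \ge 1$, let $\mu$ be a positive measure on $\mathbb{R}^d$ with support $D = \operatorname{supp}\mu$ such that $0 < \int_D p(x)^2 \, d\mu(x) < \infty$ for every nonzero real polynomial $p$ in $d$ variables. Let $\Lambda \subset \mathbb{N}_0^d$ be a finite, nonempty, downward-closed set, and let $\{(x_m, w_m)\}_{m=1}^M$ be an $M$-point quadrature rule (nodes $x_m \in D$, weights $w_m \in \mathbb{R}$) that is quasi-optimal for $\Lambda$. Then, for any maximal half-set $\Theta$ for $\Lambda$, $$w_j = \lambda_\Theta(x_j), \qquad j = 1, \dots, M.$$
   Context: Here $\mathbb{N}_0 = \{0,1,2,\dots\}$. For $x = (x^{(1)},\dots,x^{(d)}) \in \mathbb{R}^d$ and $\alpha \in \mathbb{N}_0^d$, $x^\alpha = \prod_{j=1}^d (x^{(j)})^{\alpha^{(j)}}$. For a finite multi-index set $\Lambda \subset \mathbb{N}_0^d$, $P_\Lambda = \operatorname{span}\{x^\alpha : \alpha \in \Lambda\}$ (real span). $\Lambda$ is downward closed if $\alpha \in \Lambda$ implies $\beta \in \Lambda$ for all $\beta \in \mathbb{N}_0^d$ with $\beta \le \alpha$ (componentwise). The Minkowski sum is $\Theta + \Theta = \{\alpha + \beta : \alpha, \beta \in \Theta\}$. A multi-index set $\Theta \subset \mathbb{N}_0^d$ is a half-set for $\Lambda$ if $\Theta + \Theta \subseteq \Lambda$, and a maximal half-set if in addition $|\Theta| = L(\Lambda)$, where $$L(\Lambda) = \max\{ |\Theta| \;:\; \Theta \subset \mathbb{N}_0^d,\ \Theta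 + \Theta \subseteq \Lambda \}.$$ An $M$-point quadrature rule $\{(x_m,w_m)\}_{m=1}^M$ is quasi-optimal for $\Lambda$ if $M = L(\Lambda)$ and $$\sum_{m=1}^M w_m\, p(x_m) = \int_D p(x)\, d\mu(x) \qquad \text{for all } p \in P_\Lambda .$$ For a finite nonempty multi-index set $\Theta$, let $q_1, \dots, q_{|\Theta|}$ be any basis of $P_\Theta$ that is orthonormal with respect to $\langle f, g\rangle_\mu = \int_D f(x) g(x)\, d\mu(x)$, and define $$\lambda_\Theta(x) = \frac{1}{\sum_{j=1}^{|\Theta|} q_j(x)^2},$$ which does not depend on the choice of orthonormal basis. *)

theory Defs
  imports "HOL-Analysis.Analysis" "HOL-Library.Function_Algebras"
begin

text \<open>
  Points of \<open>\<real>\<^sup>d\<close> have type \<^typ>\<open>real ^ 'd\<close> and multi-indices have type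
  \<^typ>\<open>nat ^ 'd\<close>, so \<open>d = CARD('d) \<ge> 1\<close>; the order \<open>\<le>\<close> and the addition on multi-indices
  are the componentwise library instances, and \<open>\<Theta> + \<Theta>\<close> is the Minkowski sum of
  \<open>Set_Algebras\<close>.
\<close>

definition monomial :: "nat ^ 'd \<Rightarrow> real ^ 'd \<Rightarrow> real" where
  "monomial \<alpha> x = (\<Prod>j\<in>UNIV. (x $ j) ^ (\<alpha> $ j))"

text \<open>
  Real-valued functions form a real vector space; they are not an instance of
  \<^class>\<open>real_vector\<close> in the library, so linear span and independence are taken from the locale
  \<^locale>\<open>vector_space\<close>, with addition from \<open>Function_Algebras\<close>.
\<close>

global_interpretation fun_vs: vector_space "\<lambda>(c::real) (f::'a \<Rightarrow> real) x. c * f x"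
  defines fun_span = fun_vs.span
    and fun_dependent = fun_vs.dependent
  by unfold_locales (auto simp: fun_eq_iff algebra_simps)

definition poly_space :: "(nat ^ 'd) set \<Rightarrow> (real ^ 'd \<Rightarrow> real) set" where
  "poly_space \<Lambda> = fun_span (monomial ` \<Lambda>)"

definition downward_closed :: "(nat ^ 'd) set \<Rightarrow> bool" where
  "downward_closed \<Lambda> \<longleftrightarrow> (\<forall>\<alpha>\<in>\<Lambda>. \<forall>\<beta>. \<beta> \<le> \<alpha> \<longrightarrow> \<beta> \<in> \<Lambda>)"

definition half_set :: "(nat ^ 'd) set \<Rightarrow> (nat ^ 'd) set \<Rightarrow> bool" where
  "half_set \<Theta> \<Lambda> \<longleftrightarrow> \<Theta> + \<Theta> \<subseteq> \<Lambda>"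

text \<open>
  Only meaningful for finite \<open>\<Lambda>\<close>: then every half-set is finite and of size at most
  \<^term>\<open>card \<Lambda>\<close>, because doubling is injective.
\<close>

definition max_half_size :: "(nat ^ 'd) set \<Rightarrow> nat" where
  "max_half_size \<Lambda> = Max {card \<Theta> |\<Theta>. half_set \<Theta> \<Lambda>}"

definition maximal_half_set :: "(nat ^ 'd) set \<Rightarrow> (nat ^ 'd) set \<Rightarrow> bool" where
  "maximal_half_set \<Theta> \<Lambda> \<longleftrightarrow> half_set \<Theta> \<Lambda> \<and> card \<Theta> = max_half_size \<Lambda>"

definition msupport :: "'a::topological_space measure \<Rightarrow> 'a set" where
  "msupport \<mu> = {x. \<forall>U. open U \<longrightarrow> x \<in> U \<longrightarrow> 0 < emeasure \<mu> U}"

text \<open>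
  A rule with \<open>M\<close> points has nodes \<open>x 1, \<dots>, x M\<close> and weights \<open>w 1, \<dots>, w M\<close>; values of
  \<open>x\<close> and \<open>w\<close> outside \<open>{1..M}\<close> are irrelevant.
\<close>

definition quasi_optimal ::
  "(real ^ 'd) measure \<Rightarrow> (nat ^ 'd) set \<Rightarrow> nat \<Rightarrow> (nat \<Rightarrow> real ^ 'd) \<Rightarrow> (nat \<Rightarrow> real) \<Rightarrow> bool" where
  "quasi_optimal \<mu> \<Lambda> M x w \<longleftrightarrow>
     M = max_half_size \<Lambda> \<and>
     (\<forall>p\<in>poly_space \<Lambda>. (\<Sum>m=1..M. w m * p (x m)) = (LINT y:msupport \<mu>|\<mu>. p y))"

definition orthonormal_basis ::
  "(real ^ 'd) measure \<Rightarrow> (nat ^ 'd) set \<Rightarrow> (nat \<Rightarrow> real ^ 'd \<Rightarrow> real) \<Rightarrow> bool" where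
  "orthonormal_basis \<mu> \<Theta> q \<longleftrightarrow>
     inj_on q {1..card \<Theta>} \<and>
     \<not> fun_dependent (q ` {1..card \<Theta>}) \<and>
     fun_span (q ` {1..card \<Theta>}) = poly_space \<Theta> \<and>
     (\<forall>i\<in>{1..card \<Theta>}. \<forall>j\<in>{1..card \<Theta>}.
        (LINT y:msupport \<mu>|\<mu>. q i y * q j y) = (if i = j then 1 else 0))"

text \<open>
  The definite description is the common value for all orthonormal bases of
  \<^term>\<open>poly_space \<Theta>\<close>; it is uniquely determined when \<open>\<Theta>\<close> is finite and
  \<open>(f, g) \<mapsto> \<integral> f g d\<mu>\<close> is an inner product on polynomials.
\<close>

definition christoffel ::
  "(real ^ 'd) measure \<Rightarrow> (nat ^ 'd) set \<Rightarrow> real ^ 'd \<Rightarrow> real" where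
  "christoffel \<mu> \<Theta> x =
     (THE c. \<exists>q. orthonormal_basis \<mu> \<Theta> q \<and> c = 1 / (\<Sum>j=1..card \<Theta>. (q j x)\<^sup>2))"

end

theory Submission
  imports Defs "Jordan_Normal_Form.Determinant"
begin

text \<open>
  Let \<open>q\<close> be an orthonormal basis of \<open>P\<^sub>\<Theta>\<close>. Since \<open>q\<^sub>i q\<^sub>j\<close> lies in \<open>P\<^sub>\<Lambda>\<close>, exactness of the rule reads
  \<open>V\<^sup>T W V = 1\<close> for \<open>V = (q\<^sub>j (x\<^sub>m))\<close> and \<open>W = diag w\<close>. Because \<open>M = |\<Theta>|\<close> these matrices are square,
  so also \<open>(W V) V\<^sup>T = 1\<close>, whose diagonal says \<open>w\<^sub>j \<Sum>\<^sub>i q\<^sub>i (x\<^sub>j)\<^sup>2 = 1\<close>. This holds for every orthonormal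
  basis, so it also gives the well-definedness of the Christoffel function at the nodes.
\<close>

section \<open>One-sided inverses of square matrices\<close>

text \<open>The matrix fact \<open>mat_mult_left_right_inverse\<close>, restated for sums over
  \<open>{1..n}\<close> so that it fits the numbering of nodes and basis elements.\<close>

lemma left_inverse_imp_right_inverse_sum:
  fixes A B :: "nat \<Rightarrow> nat \<Rightarrow> 'a::field"
  assumes AB: "\<And>i j. i \<in> {1..n} \<Longrightarrow> j \<in> {1..n} \<Longrightarrow>
      (\<Sum>k=1..n. A i k * B k j) = (if i = j then 1 else 0)"
    and ij: "i \<in> {1..n}" "j \<in> {1..n}"
  shows "(\<Sum>k=1..n. B i k * A k j) = (if i = j then 1 else 0)"
proof -
  define P where "P = mat n n (\<lambda>(i, j). A (Suc i) (Suc j))"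
  define Q where "Q = mat n n (\<lambda>(i, j). B (Suc i) (Suc j))"
  have c: "P \<in> carrier_mat n n" "Q \<in> carrier_mat n n"
    by (simp_all add: P_def Q_def)
  \<comment> \<open>Matrix entries are numbered from 0, the sums from 1.\<close>
  have shift: "(\<Sum>k=1..n. f k) = (\<Sum>k=0..<n. f (Suc k))" for f :: "nat \<Rightarrow> 'a"
    by (simp add: sum.atLeast1_atMost_eq atLeast0LessThan)
  have "P * Q = 1\<^sub>m n"
  proof (rule eq_matI)
    fix a b assume ab: "a < dim_row (1\<^sub>m n)" "b < dim_col (1\<^sub>m n)"
    then have "index_mat (P * Q) (a, b) = (\<Sum>k=1..n. A (Suc a) k * B k (Suc b))"
      unfolding shift by (simp add: P_def Q_def scalar_prod_def)
    also have "\<dots> = index_mat (1\<^sub>m n) (a, b)"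
      using ab by (subst AB) auto
    finally show "index_mat (P * Q) (a, b) = index_mat (1\<^sub>m n) (a, b)" .
  qed (use c in auto)
  then have QP: "Q * P = 1\<^sub>m n"
    using mat_mult_left_right_inverse c by blast
  obtain a b where ab: "i = Suc a" "j = Suc b" "a < n" "b < n"
    using ij by (metis Suc_le_D Suc_le_lessD One_nat_def atLeastAtMost_iff)
  have "(\<Sum>k=1..n. B i k * A k j) = index_mat (Q * P) (a, b)"
    unfolding shift using ab by (simp add: P_def Q_def scalar_prod_def)
  then show ?thesis
    using QP ab by simp
qed

section \<open>Linear independence of monomials\<close>

lemma sum_fun_apply: "(\<Sum>i\<in>I. f i) y = (\<Sum>i\<in>I. f i y)"
  for f :: "'i \<Rightarrow> 'a \<Rightarrow> 'b::comm_monoid_add"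
  by (induction I rule: infinite_finite_induct) auto

text \<open>Dedekind's argument, applied below to monomials as characters of the monoid \<open>\<real>\<^sup>d\<close> under
  componentwise multiplication.\<close>

lemma independent_multiplicative:
  fixes S :: "('a::times \<Rightarrow> real) set"
  assumes "finite S"
    and mult: "\<And>f x y. f \<in> S \<Longrightarrow> f (x * y) = f x * f y"
    and nz: "\<And>f. f \<in> S \<Longrightarrow> f \<noteq> (\<lambda>x. 0)"
  shows "\<not> fun_dependent S"
proof (rule fun_vs.independent_if_scalars_zero[OF \<open>finite S\<close>])
  fix c :: "('a \<Rightarrow> real) \<Rightarrow> real" and f
  assume sum0: "(\<Sum>g\<in>S. (\<lambda>x. c g * g x)) = 0" and f: "f \<in> S"
  have "\<forall>x. (\<Sum>g\<in>S. c g * g x) = 0"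
    using fun_cong[OF sum0] by (simp add: sum_fun_apply)
  with \<open>finite S\<close> mult nz have "\<forall>g\<in>S. c g = 0"
  proof (induction S arbitrary: c rule: finite_induct)
    case (insert g S)
    have c0: "c h = 0" if h: "h \<in> S" for h
    proof -
      \<comment> \<open>Take the relation at \<open>y * x\<close> and subtract \<open>g y\<close>
        times the relation at \<open>x\<close>: the term of \<open>g\<close> cancels, which leaves a
        shorter relation with coefficients \<open>c f * (f y - g y)\<close>.\<close>
      have "(\<Sum>f\<in>S. (c f * (f y - g y)) * f x) = 0" for x y
      proof -
        have "(\<Sum>f\<in>S. (c f * (f y - g y)) * f x)
            = (\<Sum>f\<in>insert g S. (c f * (f y - g y)) * f x)"
          using insert.hyps by simp
        also have "\<dots> = (\<Sum>f\<in>insert g S. c f * f (y * x)) - g y * (\<Sum>f\<in>insert g S. c f * f x)"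
          unfolding sum_distrib_left sum_subtractf[symmetric]
          by (intro sum.cong refl) (simp only: insert.prems(1), simp add: algebra_simps)
        also have "\<dots> = 0"
          using insert.prems(3) by simp
        finally show ?thesis .
      qed
      then have "c h * (h y - g y) = 0" for y
        using insert.IH[of "\<lambda>f. c f * (f y - g y)"] insert.prems h by blast
      \<comment> \<open>Distinct functions are separated by some point.\<close>
      moreover obtain y where "h y \<noteq> g y"
        using h insert.hyps by (metis ext)
      ultimately show ?thesis
        by (metis mult_eq_0_iff right_minus_eq)
    qed
    then have "c g * g x = 0" for x
      using insert.prems(3) insert.hyps by auto
    moreover obtain x where "g x \<noteq> 0"
      using insert.prems(2) by blast
    ultimately show ?case
      using c0 by (metis insertE mult_eq_0_iff)
  qed simp
  then show "c f = 0"
    using f by blast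
qed

lemma monomial_mult_point: "monomial \<alpha> (x * y) = monomial \<alpha> x * monomial \<alpha> y"
  by (simp add: monomial_def power_mult_distrib prod.distrib)

lemma monomial_add: "monomial (\<alpha> + \<beta>) x = monomial \<alpha> x * monomial \<beta> x"
  by (simp add: monomial_def power_add prod.distrib)

text \<open>Evaluation at the point with 2 in coordinate \<open>k\<close> and 1 elsewhere gives 2 to
  the power of the \<open>k\<close>-th exponent. Hence taking monomials preserves the cardinality of
  an index set.\<close>

lemma inj_monomial: "inj monomial"
proof (rule injI)
  fix \<alpha> \<beta> :: "nat ^ 'd"
  assume eq: "monomial \<alpha> = monomial \<beta>"
  have "monomial \<gamma> (vec_lambda (\<lambda>i. if i = k then 2 else 1)) = 2 ^ vec_nth \<gamma> k"
    for \<gamma> :: "nat ^ 'd" and k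
    unfolding monomial_def by (subst prod.remove[of _ k]) (auto intro!: prod.neutral)
  then have "(2::real) ^ vec_nth \<alpha> k = 2 ^ vec_nth \<beta> k" for k
    using eq by metis
  then show "\<alpha> = \<beta>"
    by (simp add: Finite_Cartesian_Product.vec_eq_iff)
qed

text \<open>Monomials are multiplicative and take the value 1 at the all-ones point, so Dedekind's
  argument applies.\<close>

lemma independent_monomials:
  fixes \<Theta> :: "(nat ^ 'd) set"
  assumes "finite \<Theta>"
  shows "\<not> fun_dependent (monomial ` \<Theta>)"
proof (rule independent_multiplicative)
  fix f :: "real ^ 'd \<Rightarrow> real" assume "f \<in> monomial ` \<Theta>"
  then obtain \<alpha> where f: "f = monomial \<alpha>" by blast
  show "f \<noteq> (\<lambda>x. 0)"
    by (rule notI, drule fun_cong[of _ _ "vec_lambda (\<lambda>_. 1)"]) (simp add: f monomial_def)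
qed (use assms in \<open>auto simp: monomial_mult_point\<close>)

section \<open>Polynomial spaces and products\<close>

lemma real_polynomial_function_monomial: "real_polynomial_function (monomial \<alpha>)"
  for \<alpha> :: "nat ^ 'd"
proof -
  have "real_polynomial_function (\<lambda>x :: real ^ 'd. \<Prod>j\<in>UNIV. vec_nth x j ^ vec_nth \<alpha> j)"
    by (intro real_polynomial_function_prod real_polynomial_function_power
        real_polynomial_function.intros(1) bounded_linear_vec_nth) simp
  then show ?thesis
    by (simp add: monomial_def[abs_def])
qed

lemma subspace_real_polynomial_function:
  "fun_vs.subspace {f :: 'a::real_normed_vector \<Rightarrow> real. real_polynomial_function f}"
  by (auto simp: fun_vs.subspace_def zero_fun_def plus_fun_def)

lemma poly_space_real_polynomial_function:
  "p \<in> poly_space \<Theta> \<Longrightarrow> real_polynomial_function p"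
  unfolding poly_space_def
  by (erule fun_vs.span_induct)
    (auto simp: subspace_real_polynomial_function real_polynomial_function_monomial)

text \<open>By bilinearity it suffices to multiply two monomials, whose exponents add up inside
  \<Theta> + \<Theta>. The inner induction expands \<open>g\<close> against a fixed monomial, the
  outer one expands \<open>f\<close>.\<close>

lemma poly_space_mult:
  assumes "\<Theta> + \<Theta> \<subseteq> \<Lambda>" "f \<in> poly_space \<Theta>" "g \<in> poly_space \<Theta>"
  shows "(\<lambda>x. f x * g x) \<in> poly_space \<Lambda>"
proof -
  have scale: "(\<lambda>x. c * h x) \<in> poly_space \<Lambda>" if "h \<in> poly_space \<Lambda>" for c h
    using that unfolding poly_space_def by (rule fun_vs.span_scale)
  have add: "(\<lambda>x. h x + k x) \<in> poly_space \<Lambda>" if "h \<in> poly_space \<Lambda>" "k \<in> poly_space \<Lambda>" for h k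
    using fun_vs.span_add that unfolding poly_space_def plus_fun_def .
  have zero: "(\<lambda>x. 0) \<in> poly_space \<Lambda>"
    using fun_vs.span_zero unfolding poly_space_def zero_fun_def .
  have mono: "(\<lambda>x. monomial \<alpha> x * g x) \<in> poly_space \<Lambda>" if \<alpha>: "\<alpha> \<in> \<Theta>" for \<alpha>
    using assms(3) unfolding poly_space_def[of \<Theta>]
  proof (induction rule: fun_vs.span_induct_alt)
    case (step c m h)
    then obtain \<beta> where \<beta>: "\<beta> \<in> \<Theta>" "m = monomial \<beta>" by blast
    have "\<alpha> + \<beta> \<in> \<Lambda>"
      using assms(1) \<alpha> \<beta> by (auto intro: set_plus_intro)
    then have "monomial (\<alpha> + \<beta>) \<in> poly_space \<Lambda>"
      unfolding poly_space_def by (intro fun_vs.span_base imageI)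
    from add[OF scale[OF this] step(2)] show ?case
      by (simp add: \<beta> monomial_add[abs_def] algebra_simps)
  qed (simp add: zero)
  show ?thesis
    using assms(2) unfolding poly_space_def[of \<Theta>]
  proof (induction rule: fun_vs.span_induct_alt)
    case (step c m h)
    then have "(\<lambda>x. m x * g x) \<in> poly_space \<Lambda>"
      using mono by blast
    from add[OF scale[OF this] step(2)] show ?case
      by (simp add: algebra_simps)
  qed (simp add: zero)
qed

section \<open>Gram-Schmidt orthonormalisation\<close>

text \<open>The form is controlled only on a subspace \<open>V\<close>, because the integral of a
  product is bilinear only where the products are integrable. The induction orthonormalises one
  further vector at a time.\<close>

lemma gram_schmidt_fun:
  fixes B :: "('a \<Rightarrow> real) \<Rightarrow> ('a \<Rightarrow> real) \<Rightarrow> real"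
  assumes V: "fun_vs.subspace V"
    and lin: "\<And>a b f g h. f \<in> V \<Longrightarrow> g \<in> V \<Longrightarrow> h \<in> V \<Longrightarrow>
        B (\<lambda>x. a * f x + b * g x) h = a * B f h + b * B g h"
    and sym: "\<And>f g. f \<in> V \<Longrightarrow> g \<in> V \<Longrightarrow> B f g = B g f"
    and pos: "\<And>f. f \<in> V \<Longrightarrow> f \<noteq> (\<lambda>x. 0) \<Longrightarrow> 0 < B f f"
    and S: "finite S" "S \<subseteq> V" "\<not> fun_dependent S"
  shows "\<exists>q. inj_on q {1..card S} \<and> \<not> fun_dependent (q ` {1..card S}) \<and>
     fun_span (q ` {1..card S}) = fun_span S \<and>
     (\<forall>i\<in>{1..card S}. \<forall>j\<in>{1..card S}. B (q i) (q j) = (if i = j then 1 else 0))"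
  using S
proof (induction S rule: finite_induct)
  case empty
  then show ?case by (auto simp: fun_vs.independent_empty)
next
  case (insert m S)
  have ind: "\<not> fun_dependent S" and mS: "m \<notin> fun_span S"
    using insert.prems(2) insert.hyps(2) by (auto simp: fun_vs.independent_insert)
  define n where "n = card S"
  obtain q where q: "inj_on q {1..n}" "\<not> fun_dependent (q ` {1..n})"
      "fun_span (q ` {1..n}) = fun_span S"
      "\<And>i j. i \<in> {1..n} \<Longrightarrow> j \<in> {1..n} \<Longrightarrow> B (q i) (q j) = (if i = j then 1 else 0)"
    using insert.IH[OF _ ind] insert.prems unfolding n_def by auto
  have spanV: "fun_span S \<subseteq> V"
    using insert.prems V by (intro fun_vs.span_minimal) auto
  have qS: "q i \<in> fun_span S" if "i \<in> {1..n}" for i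
    using that unfolding q(3)[symmetric] by (intro fun_vs.span_base imageI)
  have mV: "m \<in> V"
    using insert.prems by blast
  have addV: "(\<lambda>x. f x + g x) \<in> V" if "f \<in> V" "g \<in> V" for f g
    using fun_vs.subspace_add[OF V that] unfolding plus_fun_def .
  have scaleV: "(\<lambda>x. a * f x) \<in> V" if "f \<in> V" for a f
    using fun_vs.subspace_scale[OF V that] .
  \<comment> \<open>The orthogonal projection of \<open>m\<close> onto the span of
    \<open>S\<close>.\<close>
  define s where "s = (\<Sum>j=1..n. (\<lambda>x. B m (q j) * q j x))"
  have sS: "s \<in> fun_span S"
    unfolding s_def by (intro fun_vs.span_sum fun_vs.span_scale qS)
  have Bs: "B s (q i) = B m (q i)" if i: "i \<in> {1..n}" for i
  proof -
    have qV: "q i \<in> V" using qS[OF i] spanV by blast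
    \<comment> \<open>Membership in \<open>V\<close> is carried along in the induction, since
      \<open>lin\<close> can split a sum only inside \<open>V\<close>.\<close>
    have "J \<subseteq> {1..n} \<Longrightarrow> finite J \<Longrightarrow>
        (\<Sum>j\<in>J. (\<lambda>x. B m (q j) * q j x)) \<in> V \<and>
        B (\<Sum>j\<in>J. (\<lambda>x. B m (q j) * q j x)) (q i) = (if i \<in> J then B m (q i) else 0)" for J
    proof (induction J rule: infinite_finite_induct)
      case empty
      show ?case
        \<comment> \<open>Linearity with both coefficients 0 shows that the form vanishes at the
          zero function.\<close>
        using lin[OF qV qV qV, of 0 0] fun_vs.subspace_0[OF V] by (simp add: zero_fun_def)
    next
      case (insert j J)
      have jn: "j \<in> {1..n}" using insert.prems by blast
      then have jV: "q j \<in> V" using qS spanV by blast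
      let ?t = "\<Sum>j\<in>J. (\<lambda>x. B m (q j) * q j x)"
      have t: "?t \<in> V" "B ?t (q i) = (if i \<in> J then B m (q i) else 0)"
        using insert by auto
      have "(\<Sum>j\<in>insert j J. (\<lambda>x. B m (q j) * q j x)) = (\<lambda>x. B m (q j) * q j x + 1 * ?t x)"
        using insert.hyps by (simp add: plus_fun_def)
      moreover have "B (\<lambda>x. B m (q j) * q j x + 1 * ?t x) (q i)
          = B m (q j) * B (q j) (q i) + 1 * B ?t (q i)"
        by (rule lin[OF jV t(1) qV])
      moreover have "(\<lambda>x. B m (q j) * q j x + 1 * ?t x) \<in> V"
        using addV[OF scaleV[OF jV] t(1)] by simp
      ultimately show ?case
        using t(2) q(4)[OF jn i] insert.hyps by auto
    qed simp
    from this[of "{1..n}"] show ?thesis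
      using i by (simp add: s_def)
  qed
  have sV: "s \<in> V" using sS spanV by blast
  \<comment> \<open>The explicit coefficients 1 and -1 give \<open>r\<close> the shape of the left
    side of \<open>lin\<close>.\<close>
  define r where "r = (\<lambda>x. 1 * m x + (-1) * s x)"
  have rm: "r = m - s" by (simp add: r_def fun_eq_iff)
  have rV: "r \<in> V"
    unfolding r_def by (intro addV scaleV mV sV)
  \<comment> \<open>Otherwise \<open>m = r + s\<close> would lie in the span of \<open>S\<close>. In
    particular \<open>r\<close> is nonzero and can be normalised.\<close>
  have rS: "r \<notin> fun_span S"
    using mS sS fun_vs.span_add[of r S s] by (auto simp: rm)
  have Brq: "B r (q i) = 0" if i: "i \<in> {1..n}" for i
    unfolding r_def using qS[OF i] spanV by (subst lin) (auto simp: mV sV Bs[OF i])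
  have Brr: "B r r > 0"
    using pos[OF rV] rS fun_vs.span_zero[of S] unfolding zero_fun_def by metis
  define c where "c = 1 / sqrt (B r r)"
  have c0: "c \<noteq> 0" and cc: "c * (c * B r r) = 1"
    using Brr by (simp_all add: c_def field_simps)
  define u where "u = (\<lambda>x. c * r x)"
  have uV: "u \<in> V" unfolding u_def by (rule scaleV[OF rV])
  have r_u: "r = (\<lambda>x. (1 / c) * u x)" using c0 by (simp add: u_def)
  have uS: "u \<notin> fun_span S"
    using rS fun_vs.span_scale[of u S "1 / c"] unfolding r_u[symmetric] by blast
  have Bu: "B u f = c * B r f" if "f \<in> V" for f
    using lin[OF rV rV that, of c 0] by (simp add: u_def)
  have Buq: "B u (q i) = 0" "B (q i) u = 0" if "i \<in> {1..n}" for i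
    using Bu[of "q i"] Brq[OF that] qS[OF that] spanV sym[OF uV, of "q i"] by auto
  have Buu: "B u u = 1"
    using Bu[OF uV] Bu[OF rV] sym[OF rV uV] cc by simp
  \<comment> \<open>Two exchanges: \<open>u\<close> is a nonzero multiple of \<open>r\<close>, and
    \<open>r\<close> differs from \<open>m\<close> by an element of the span of
    \<open>S\<close>.\<close>
  have span_u: "fun_span (insert u (q ` {1..n})) = fun_span (insert m S)"
  proof -
    have "fun_span (insert u (q ` {1..n})) = fun_span (insert u S)"
      unfolding fun_vs.span_insert q(3) ..
    also have "\<dots> = fun_span (insert r S)"
    proof -
      have "u \<in> fun_span (insert r S)"
        unfolding u_def by (intro fun_vs.span_scale fun_vs.span_base) simp
      moreover have "r \<in> fun_span (insert u S)"
        by (subst r_u, intro fun_vs.span_scale fun_vs.span_base) simp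
      ultimately show ?thesis
        unfolding fun_vs.span_eq by (auto intro: fun_vs.span_base)
    qed
    also have "\<dots> = fun_span (insert m S)"
      using fun_vs.span_neg[OF sS] by (intro fun_vs.eq_span_insert_eq) (simp add: rm)
    finally show ?thesis .
  qed
  define p where "p = q(Suc n := u)"
  have card: "card (insert m S) = Suc n"
    using insert.hyps by (simp add: n_def)
  have dom: "{1..Suc n} = insert (Suc n) {1..n}" by auto
  have pq: "p i = q i" if "i \<in> {1..n}" for i
    using that by (simp add: p_def)
  have pu: "p (Suc n) = u" by (simp add: p_def)
  have "p ` {1..n} = q ` {1..n}" by (rule image_cong[OF refl pq])
  then have im: "p ` {1..Suc n} = insert u (q ` {1..n})"
    unfolding dom by (simp add: pu)
  have "inj_on p {1..n}"
    using q(1) inj_on_cong[of "{1..n}" p q] pq by blast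
  moreover have "u \<notin> p ` {1..n}"
    using uS qS pq by fastforce
  ultimately have "inj_on p {1..Suc n}"
    unfolding dom by (simp add: pu)
  moreover have "\<not> fun_dependent (p ` {1..Suc n})"
    unfolding im using q(2) uS q(3) by (intro fun_vs.independent_insertI) auto
  moreover have "B (p i) (p j) = (if i = j then 1 else 0)"
    if "i \<in> {1..Suc n}" "j \<in> {1..Suc n}" for i j
    using that unfolding dom
    by (auto simp: pu pq Buu Buq q(4))
  ultimately show ?case
    unfolding card using im span_u by (intro exI[of _ p]) auto
qed

section \<open>Integrability and orthonormal bases of polynomials\<close>

text \<open>The complement is the union of all open null sets. Closedness makes the domain of
  integration measurable.\<close>

lemma closed_msupport: "closed (msupport \<mu>)"
proof -
  have "- msupport \<mu> = \<Union> {U. open U \<and> emeasure \<mu> U = 0}"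
    by (auto simp: msupport_def zero_less_iff_neq_zero)
  then show ?thesis
    unfolding closed_def by auto
qed

text \<open>Polarization: twice \<open>f * g\<close> is the square of \<open>f + g\<close> minus the
  squares of \<open>f\<close> and \<open>g\<close>, and squares of polynomials have finite
  integral.\<close>

lemma integrable_mult_polynomials:
  fixes \<mu> :: "(real ^ 'd) measure"
  assumes borel: "sets \<mu> = sets borel"
    and fin: "\<And>p. real_polynomial_function p \<Longrightarrow> p \<noteq> (\<lambda>y. 0) \<Longrightarrow>
                (\<integral>\<^sup>+y\<in>msupport \<mu>. ennreal ((p y)\<^sup>2) \<partial>\<mu>) < \<infinity>"
    and f: "real_polynomial_function f" and g: "real_polynomial_function g"
  shows "set_integrable \<mu> (msupport \<mu>) (\<lambda>y. f y * g y)"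
proof -
  have D: "msupport \<mu> \<in> sets \<mu>"
    unfolding borel by (intro borel_closed closed_msupport)
  have meas: "p \<in> borel_measurable \<mu>" if "real_polynomial_function p" for p :: "real ^ 'd \<Rightarrow> real"
    using that continuous_on_polymonial_function[of p UNIV] borel
    by (metis borel_measurable_continuous_onI measurable_cong_sets real_polynomial_function_eq)
  have sq: "set_integrable \<mu> (msupport \<mu>) (\<lambda>y. (p y)\<^sup>2)" if p: "real_polynomial_function p" for p
  \<comment> \<open>\<open>fin\<close> speaks of nonzero polynomials only; the zero polynomial is
    trivially integrable.\<close>
  proof (cases "p = (\<lambda>y. 0)")
    case False
    have "(\<integral>\<^sup>+ y. ennreal (norm (indicator (msupport \<mu>) y *\<^sub>R (p y)\<^sup>2)) \<partial>\<mu>)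
        = (\<integral>\<^sup>+y\<in>msupport \<mu>. ennreal ((p y)\<^sup>2) \<partial>\<mu>)"
      by (intro nn_integral_cong) (auto simp: indicator_def)
    then show ?thesis
      unfolding set_integrable_def using fin[OF p False] meas[OF p] D
      by (intro integrableI_bounded) auto
  qed (simp add: set_integrable_def)
  have "set_integrable \<mu> (msupport \<mu>) (\<lambda>y. (1/2) * ((f y + g y)\<^sup>2 - (f y)\<^sup>2 - (g y)\<^sup>2))"
    using f g by (intro set_integrable_mult_right set_integral_diff(1) sq) auto
  then show ?thesis
    by (simp add: power2_eq_square algebra_simps)
qed

text \<open>Gram-Schmidt applied to the monomials of \<Theta>, inside the space of all
  polynomials.\<close>

lemma orthonormal_basis_exists:
  fixes \<mu> :: "(real ^ 'd) measure"
  assumes borel: "sets \<mu> = sets borel"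
    and pos: "\<And>p. real_polynomial_function p \<Longrightarrow> p \<noteq> (\<lambda>y. 0) \<Longrightarrow>
                0 < (\<integral>\<^sup>+y\<in>msupport \<mu>. ennreal ((p y)\<^sup>2) \<partial>\<mu>)"
    and fin: "\<And>p. real_polynomial_function p \<Longrightarrow> p \<noteq> (\<lambda>y. 0) \<Longrightarrow>
                (\<integral>\<^sup>+y\<in>msupport \<mu>. ennreal ((p y)\<^sup>2) \<partial>\<mu>) < \<infinity>"
    and "finite \<Theta>"
  shows "\<exists>q. orthonormal_basis \<mu> \<Theta> q"
proof -
  let ?B = "\<lambda>f g. LINT y:msupport \<mu>|\<mu>. f y * g y"
  let ?V = "{f :: real ^ 'd \<Rightarrow> real. real_polynomial_function f}"
  have int: "set_integrable \<mu> (msupport \<mu>) (\<lambda>y. f y * g y)"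
    if "real_polynomial_function f" "real_polynomial_function g" for f g
    using integrable_mult_polynomials[OF borel _ that] fin by blast
  have lin: "?B (\<lambda>x. a * f x + b * g x) h = a * ?B f h + b * ?B g h"
    if "f \<in> ?V" "g \<in> ?V" "h \<in> ?V" for a b f g h
  proof -
    have "?B (\<lambda>x. a * f x + b * g x) h = (LINT y:msupport \<mu>|\<mu>. a * (f y * h y) + b * (g y * h y))"
      by (simp add: algebra_simps)
    also have "\<dots> = a * ?B f h + b * ?B g h"
      using that by (subst set_integral_add(2)) (auto intro!: set_integrable_mult_right int)
    finally show ?thesis .
  qed
  have "0 < ?B f f" if "f \<in> ?V" "f \<noteq> (\<lambda>x. 0)" for f
  proof -
    have f: "real_polynomial_function f" using that by simp
    \<comment> \<open>Integrability identifies the Bochner integral with the nonnegative one, so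
      positivity is not lost to the default value 0.\<close>
    have "ennreal (?B f f) = (\<integral>\<^sup>+y. ennreal (indicator (msupport \<mu>) y * (f y * f y)) \<partial>\<mu>)"
      using int[OF f f] unfolding set_lebesgue_integral_def set_integrable_def
      by (subst nn_integral_eq_integral) auto
    also have "\<dots> = (\<integral>\<^sup>+y\<in>msupport \<mu>. ennreal ((f y)\<^sup>2) \<partial>\<mu>)"
      by (intro nn_integral_cong) (auto simp: indicator_def power2_eq_square)
    finally have "0 < ennreal (?B f f)"
      using pos[OF f that(2)] by simp
    then show ?thesis by simp
  qed
  moreover have "card (monomial ` \<Theta>) = card \<Theta>"
    by (rule card_image) (rule inj_on_subset[OF inj_monomial], simp)
  ultimately show ?thesis
    using gram_schmidt_fun[OF subspace_real_polynomial_function, of ?B "monomial ` \<Theta>"] lin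
      \<open>finite \<Theta>\<close> independent_monomials[OF \<open>finite \<Theta>\<close>]
    by (simp add: orthonormal_basis_def poly_space_def mult.commute
        real_polynomial_function_monomial image_subset_iff)
qed

section \<open>Weights of the quadrature rule\<close>

text \<open>The weights go into one factor only, so negative ones require no square roots:
  \<open>A i m = q i (x m)\<close> and \<open>B m k = w m * q k (x m)\<close>. Exactness gives
  \<open>A B = 1\<close>, and the diagonal entry \<open>(j, j)\<close> of \<open>B A = 1\<close> is
  the claim.\<close>

lemma quadrature_weight_eq:
  assumes exact: "\<forall>p\<in>poly_space \<Lambda>. (\<Sum>m=1..card \<Theta>. w m * p (x m)) = (LINT y:msupport \<mu>|\<mu>. p y)"
    and half: "\<Theta> + \<Theta> \<subseteq> \<Lambda>"
    and q: "orthonormal_basis \<mu> \<Theta> q"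
    and j: "j \<in> {1..card \<Theta>}"
  shows "w j = 1 / (\<Sum>i=1..card \<Theta>. (q i (x j))\<^sup>2)"
proof -
  have qP: "q i \<in> poly_space \<Theta>" if "i \<in> {1..card \<Theta>}" for i
    using q that unfolding orthonormal_basis_def by (metis fun_vs.span_base imageI)
  have "(\<Sum>m=1..card \<Theta>. q i (x m) * (w m * q k (x m))) = (if i = k then 1 else 0)"
    if "i \<in> {1..card \<Theta>}" "k \<in> {1..card \<Theta>}" for i k
  proof -
    have "(\<Sum>m=1..card \<Theta>. q i (x m) * (w m * q k (x m))) = (\<Sum>m=1..card \<Theta>. w m * (q i (x m) * q k (x m)))"
      by (simp add: mult_ac)
    also have "\<dots> = (LINT y:msupport \<mu>|\<mu>. q i y * q k y)"
      using exact poly_space_mult[OF half] qP that by auto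
    also have "\<dots> = (if i = k then 1 else 0)"
      using q that unfolding orthonormal_basis_def by blast
    finally show ?thesis .
  qed
  from left_inverse_imp_right_inverse_sum[of "card \<Theta>" "\<lambda>i m. q i (x m)" "\<lambda>m k. w m * q k (x m)",
      OF this j j]
  have "w j * (\<Sum>i=1..card \<Theta>. (q i (x j))\<^sup>2) = 1"
    by (simp add: sum_distrib_left power2_eq_square mult.assoc)
  then show ?thesis
    \<comment> \<open>A product equal to 1 has no zero factor, so the division is
      legitimate.\<close>
    by (metis mult_zero_right nonzero_eq_divide_eq zero_neq_one)
qed

theorem theorem2p3:
  fixes \<mu> :: "(real ^ 'd) measure"
    and \<Lambda> \<Theta> :: "(nat ^ 'd) set"
    and M :: nat
    and x :: "nat \<Rightarrow> real ^ 'd"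
    and w :: "nat \<Rightarrow> real"
  assumes borel: "sets \<mu> = sets borel"
    and pos: "\<And>p. real_polynomial_function p \<Longrightarrow> p \<noteq> (\<lambda>y. 0) \<Longrightarrow>
                0 < (\<integral>\<^sup>+y\<in>msupport \<mu>. ennreal ((p y)\<^sup>2) \<partial>\<mu>)"
    and fin: "\<And>p. real_polynomial_function p \<Longrightarrow> p \<noteq> (\<lambda>y. 0) \<Longrightarrow>
                (\<integral>\<^sup>+y\<in>msupport \<mu>. ennreal ((p y)\<^sup>2) \<partial>\<mu>) < \<infinity>"
    and "finite \<Lambda>" and "\<Lambda> \<noteq> {}" and "downward_closed \<Lambda>"
    and nodes: "\<forall>m\<in>{1..M}. x m \<in> msupport \<mu>"
    and rule: "quasi_optimal \<mu> \<Lambda> M x w"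
    and half: "maximal_half_set \<Theta> \<Lambda>"
  shows "\<forall>j\<in>{1..M}. w j = christoffel \<mu> \<Theta> (x j)"
proof
  fix j assume j: "j \<in> {1..M}"
  have M: "M = card \<Theta>" and sum: "\<Theta> + \<Theta> \<subseteq> \<Lambda>"
    using rule half by (simp_all add: quasi_optimal_def maximal_half_set_def half_set_def)
  have exact: "\<forall>p\<in>poly_space \<Lambda>. (\<Sum>m=1..card \<Theta>. w m * p (x m)) = (LINT y:msupport \<mu>|\<mu>. p y)"
    using rule unfolding quasi_optimal_def M by blast
  \<comment> \<open>The index \<open>j\<close> forces \<open>card \<Theta> > 0\<close>, whereas
    infinite sets have cardinality 0.\<close>
  have "finite \<Theta>"
    using j M by (auto intro: card_ge_0_finite)
  then obtain q where q: "orthonormal_basis \<mu> \<Theta> q"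
    using orthonormal_basis_exists[OF borel] pos fin by blast
  show "w j = christoffel \<mu> \<Theta> (x j)"
    unfolding christoffel_def
  proof (rule the_equality[symmetric])
    show "\<exists>q. orthonormal_basis \<mu> \<Theta> q \<and> w j = 1 / (\<Sum>i=1..card \<Theta>. (q i (x j))\<^sup>2)"
      using q quadrature_weight_eq[OF exact sum q] j M by blast
  next
    fix c assume "\<exists>q. orthonormal_basis \<mu> \<Theta> q \<and> c = 1 / (\<Sum>i=1..card \<Theta>. (q i (x j))\<^sup>2)"
    then show "c = w j"
      using quadrature_weight_eq[OF exact sum] j M by metis
  qed
qed

end
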